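(* Let $G$ be a group, let $X$ be a set, and let $\phi : G \to \mathrm{Aut}(X)$ be a (left) group action of $G$ on $X$. Let $X /\!\!/ G$ be the associated transformation groupoid, and let $\mathbf{G}$ be the one-object category with object $\star$ and $\mathbf{G}(\star,\star) = G$. Then there is a strict contravariant functor $\bar{F} : \mathbf{G} \to \mathbf{Set}$ with $\bar{F}(\star) = X$ such that $X /\!\!/ G$ is isomorphic, as a category, to the base-structured category $\int_{\mathbf{G}} \bar{F}$.
   Context: Transformation groupoid: for a group action $\phi : G \to \mathrm{Aut}(X)$, where $\phi_g$ denotes $\phi(g)$ and $\mathrm{Aut}(X)$ is the group of bijections of $X$, the groupoid $X /\!\!/ G$ has as objects the elements $x \in X$. Its morphisms $x \to y$ are the pairs $(g,x) \in G \times X$ with $\phi_g(x) = y$. Composition is $(g', \phi_g(x)) \circ (g,x) = (g'g, x)$. One-object category: composition in $\mathbf{G}$ is the multiplication of $G$, i.e. $g' \circ g = g'g$. Base-structured category (concrete right action): let $\mathbf{C}$ be a small category and $\bar{F} : \mathbf{C} \to \mathbf{Set}$ a strict contravariant functor, so that $\bar{F}(g \circ f) = \bar{F}(f) \circ \bar{F}(g)$ and identities are preserved. The category $\int_{\mathbf{C}} \bar{F}$ is defined as follows. - Objects: pairs $(A,x)$ with $A \in \mathrm{Ob}(\mathbf{C})$ and $x \in \bar{F}(A)$. - Morphisms $(A,x) \to (B,y)$: pairs $(f,x)$ where $f : A \to B$ is a morphism of $\mathbf{C}$ with $x = \bar{F}(f)(y)$. Source and target are part of the data of a morphism. - Identity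 of $(A,x)$: $(\mathrm{id}_A, x)$. - Composition: for $(f,x) : (A,x) \to (B,y)$ and $(g,y) : (B,y) \to (C,z)$, $(g,y) \bullet (f,x) = (g \circ f, x)$. *)

theory Defs
  imports "HOL-Algebra.Group_Action"
begin

section \<open>Small categories and functors\<close>

text \<open>
  A category is given by a family of hom-sets indexed by pairs of objects.  The hom-sets need not
  be disjoint: an element of the morphism type is a morphism only relative to a chosen source and
  target, which is why identities and composition take objects as arguments.  Only values at
  objects in \<^term>\<open>Ob\<close> and at elements of the relevant hom-sets carry meaning.
  \<open>Cmp C A B D g f\<close> is the composite of \<open>f : A \<rightarrow> B\<close> followed by \<open>g : B \<rightarrow> D\<close>.
\<close>

record ('o, 'm) cat =
  Ob :: "'o set"
  Mor :: "'o \<Rightarrow> 'o \<Rightarrow> 'm set"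
  Idn :: "'o \<Rightarrow> 'm"
  Cmp :: "'o \<Rightarrow> 'o \<Rightarrow> 'o \<Rightarrow> 'm \<Rightarrow> 'm \<Rightarrow> 'm"

locale category =
  fixes C :: "('o, 'm) cat"
  assumes Idn_in_Mor: "A \<in> Ob C \<Longrightarrow> Idn C A \<in> Mor C A A"
    and Cmp_in_Mor: "\<lbrakk>A \<in> Ob C; B \<in> Ob C; D \<in> Ob C; f \<in> Mor C A B; g \<in> Mor C B D\<rbrakk>
      \<Longrightarrow> Cmp C A B D g f \<in> Mor C A D"
    and Cmp_Idn_right: "\<lbrakk>A \<in> Ob C; B \<in> Ob C; f \<in> Mor C A B\<rbrakk> \<Longrightarrow> Cmp C A A B f (Idn C A) = f"
    and Cmp_Idn_left: "\<lbrakk>A \<in> Ob C; B \<in> Ob C; f \<in> Mor C A B\<rbrakk> \<Longrightarrow> Cmp C A B B (Idn C B) f = f"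
    and Cmp_assoc: "\<lbrakk>A \<in> Ob C; B \<in> Ob C; D \<in> Ob C; E \<in> Ob C;
        f \<in> Mor C A B; g \<in> Mor C B D; h \<in> Mor C D E\<rbrakk>
      \<Longrightarrow> Cmp C A D E h (Cmp C A B D g f) = Cmp C A B E (Cmp C B D E h g) f"

record ('o1, 'm1, 'o2, 'm2) fctr =
  ObMap :: "'o1 \<Rightarrow> 'o2"
  MorMap :: "'o1 \<Rightarrow> 'o1 \<Rightarrow> 'm1 \<Rightarrow> 'm2"

locale covariant_functor = C: category C + D: category D
  for C :: "('o1, 'm1) cat" and D :: "('o2, 'm2) cat" +
  fixes F :: "('o1, 'm1, 'o2, 'm2) fctr"
  assumes ObMap_in_Ob: "A \<in> Ob C \<Longrightarrow> ObMap F A \<in> Ob D"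
    and MorMap_in_Mor: "\<lbrakk>A \<in> Ob C; B \<in> Ob C; f \<in> Mor C A B\<rbrakk>
      \<Longrightarrow> MorMap F A B f \<in> Mor D (ObMap F A) (ObMap F B)"
    and MorMap_Idn: "A \<in> Ob C \<Longrightarrow> MorMap F A A (Idn C A) = Idn D (ObMap F A)"
    and MorMap_Cmp: "\<lbrakk>A1 \<in> Ob C; A2 \<in> Ob C; A3 \<in> Ob C; f \<in> Mor C A1 A2; g \<in> Mor C A2 A3\<rbrakk>
      \<Longrightarrow> MorMap F A1 A3 (Cmp C A1 A2 A3 g f)
        = Cmp D (ObMap F A1) (ObMap F A2) (ObMap F A3) (MorMap F A2 A3 g) (MorMap F A1 A2 f)"

locale contravariant_functor = C: category C + D: category D
  for C :: "('o1, 'm1) cat" and D :: "('o2, 'm2) cat" +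
  fixes F :: "('o1, 'm1, 'o2, 'm2) fctr"
  assumes ObMap_in_Ob: "A \<in> Ob C \<Longrightarrow> ObMap F A \<in> Ob D"
    and MorMap_in_Mor: "\<lbrakk>A \<in> Ob C; B \<in> Ob C; f \<in> Mor C A B\<rbrakk>
      \<Longrightarrow> MorMap F A B f \<in> Mor D (ObMap F B) (ObMap F A)"
    and MorMap_Idn: "A \<in> Ob C \<Longrightarrow> MorMap F A A (Idn C A) = Idn D (ObMap F A)"
    and MorMap_Cmp: "\<lbrakk>A1 \<in> Ob C; A2 \<in> Ob C; A3 \<in> Ob C; f \<in> Mor C A1 A2; g \<in> Mor C A2 A3\<rbrakk>
      \<Longrightarrow> MorMap F A1 A3 (Cmp C A1 A2 A3 g f)
        = Cmp D (ObMap F A3) (ObMap F A2) (ObMap F A1) (MorMap F A1 A2 f) (MorMap F A2 A3 g)"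

text \<open>
  An isomorphism of categories is a functor with a strict two-sided inverse functor.  Both
  arguments are required to be categories, since the functor locale extends \<^locale>\<open>category\<close>.
\<close>

definition isomorphic_cat :: "('o1, 'm1) cat \<Rightarrow> ('o2, 'm2) cat \<Rightarrow> bool" where
  "isomorphic_cat C D \<longleftrightarrow> (\<exists>F K.
     covariant_functor C D F \<and> covariant_functor D C K \<and>
     (\<forall>A\<in>Ob C. ObMap K (ObMap F A) = A) \<and>
     (\<forall>A\<in>Ob C. \<forall>B\<in>Ob C. \<forall>f\<in>Mor C A B.
        MorMap K (ObMap F A) (ObMap F B) (MorMap F A B f) = f) \<and>
     (\<forall>A\<in>Ob D. ObMap F (ObMap K A) = A) \<and>
     (\<forall>A\<in>Ob D. \<forall>B\<in>Ob D. \<forall>f\<in>Mor D A B.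
        MorMap F (ObMap K A) (ObMap K B) (MorMap K A B f) = f))"


section \<open>The categories involved\<close>

text \<open>
  The category of sets whose elements are drawn from the type \<open>'x\<close>.  Maps \<open>A \<rightarrow> B\<close> are
  represented by total functions that are undefined outside \<open>A\<close>, so that equality of maps is
  equality of functions.
\<close>

definition set_cat :: "('x set, 'x \<Rightarrow> 'x) cat" where
  "set_cat = \<lparr>Ob = UNIV,
     Mor = (\<lambda>A B. A \<rightarrow>\<^sub>E B),
     Idn = (\<lambda>A. \<lambda>x\<in>A. x),
     Cmp = (\<lambda>A B D g f. compose A g f)\<rparr>"

definition one_object_cat :: "('g, 'r) monoid_scheme \<Rightarrow> (unit, 'g) cat" where
  "one_object_cat G = \<lparr>Ob = {()},
     Mor = (\<lambda>_ _. carrier G),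
     Idn = (\<lambda>_. \<one>\<^bsub>G\<^esub>),
     Cmp = (\<lambda>_ _ _ g' g. g' \<otimes>\<^bsub>G\<^esub> g)\<rparr>"

definition transformation_groupoid ::
    "('g, 'r) monoid_scheme \<Rightarrow> 'x set \<Rightarrow> ('g \<Rightarrow> 'x \<Rightarrow> 'x) \<Rightarrow> ('x, 'g \<times> 'x) cat" where
  "transformation_groupoid G X \<phi> = \<lparr>Ob = X,
     Mor = (\<lambda>x y. {(g, x) | g. g \<in> carrier G \<and> \<phi> g x = y}),
     Idn = (\<lambda>x. (\<one>\<^bsub>G\<^esub>, x)),
     Cmp = (\<lambda>_ _ _ (g', _) (g, x). (g' \<otimes>\<^bsub>G\<^esub> g, x))\<rparr>"

definition base_structured_cat ::
    "('o, 'm) cat \<Rightarrow> ('o, 'm, 'x set, 'x \<Rightarrow> 'x) fctr \<Rightarrow> ('o \<times> 'x, 'm \<times> 'x) cat" where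
  "base_structured_cat C F = \<lparr>Ob = (SIGMA A:Ob C. ObMap F A),
     Mor = (\<lambda>(A, x) (B, y). {(f, x) | f. f \<in> Mor C A B \<and> x = MorMap F A B f y}),
     Idn = (\<lambda>(A, x). (Idn C A, x)),
     Cmp = (\<lambda>(A, _) (B, _) (D, _) (g, _) (f, x). (Cmp C A B D g f, x))\<rparr>"


section \<open>Well-definedness\<close>

lemma category_set_cat: "category set_cat"
  by unfold_locales
    (auto simp: set_cat_def compose_def restrict_def fun_eq_iff PiE_iff extensional_def)

lemma (in group) category_one_object_cat: "category (one_object_cat G)"
  by unfold_locales (auto simp: one_object_cat_def m_assoc)

lemma (in group_action) mult_action:
  assumes "g \<in> carrier G" "h \<in> carrier G" "x \<in> E"
  shows "\<phi> (g \<otimes> h) x = \<phi> g (\<phi> h x)"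
  using composition_rule assms by simp

lemma (in group_action) one_action: "x \<in> E \<Longrightarrow> \<phi> \<one> x = x"
  using id_eq_one by (metis restrict_apply')

lemma (in group_action) category_transformation_groupoid:
  "category (transformation_groupoid G E \<phi>)"
proof -
  interpret group G using group_hom by (rule group_hom.axioms)
  show ?thesis
    by unfold_locales
      (auto simp: transformation_groupoid_def mult_action one_action m_assoc)
qed

lemma (in group_action) transformation_groupoid_invertible:
  assumes "x \<in> E" "y \<in> E" "f \<in> Mor (transformation_groupoid G E \<phi>) x y"
  shows "\<exists>f'\<in>Mor (transformation_groupoid G E \<phi>) y x.
    Cmp (transformation_groupoid G E \<phi>) x y x f' f = Idn (transformation_groupoid G E \<phi>) x \<and>
    Cmp (transformation_groupoid G E \<phi>) y x y f f' = Idn (transformation_groupoid G E \<phi>) y"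
proof -
  interpret group G using group_hom by (rule group_hom.axioms)
  from assms obtain g where g: "f = (g, x)" "g \<in> carrier G" "\<phi> g x = y"
    by (auto simp: transformation_groupoid_def)
  then have "\<phi> (inv g) y = x"
    using assms orbit_sym_aux by blast
  with g show ?thesis
    by (intro bexI[of _ "(inv g, y)"]) (auto simp: transformation_groupoid_def)
qed

lemma category_base_structured_cat:
  assumes "contravariant_functor C set_cat F"
  shows "category (base_structured_cat C F)"
proof -
  interpret contravariant_functor C set_cat F by (rule assms)
  have id: "MorMap F A A (Idn C A) x = x" if "A \<in> Ob C" "x \<in> ObMap F A" for A x
    using MorMap_Idn[of A] that by (simp add: set_cat_def)
  have cmp: "MorMap F A1 A3 (Cmp C A1 A2 A3 g f) z = MorMap F A1 A2 f (MorMap F A2 A3 g z)"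
    if "A1 \<in> Ob C" "A2 \<in> Ob C" "A3 \<in> Ob C" "f \<in> Mor C A1 A2" "g \<in> Mor C A2 A3" "z \<in> ObMap F A3"
    for A1 A2 A3 f g z
    using MorMap_Cmp[of A1 A2 A3 f g] that by (simp add: set_cat_def compose_def)
  show ?thesis
    by unfold_locales
      (auto simp: base_structured_cat_def id cmp C.Idn_in_Mor C.Cmp_in_Mor C.Cmp_Idn_left
        C.Cmp_Idn_right C.Cmp_assoc)
qed

end

theory Submission
  imports Defs
begin

text \<open>
  A contravariant functor on the one-object category of \<open>G\<close> is a right action of \<open>G\<close>, and every
  left action \<open>\<phi>\<close> becomes a right action through \<open>g \<mapsto> \<phi> (inv g)\<close>, inversion being an
  anti-automorphism of \<open>G\<close>. With this choice of \<open>F\<close>, the condition \<open>x = F(g)(y)\<close> for \<open>(g, x)\<close> to be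
  a morphism \<open>(\<star>, x) \<rightarrow> (\<star>, y)\<close> of the base-structured category reads \<open>x = \<phi> (inv g) y\<close>, which is
  the same as \<open>\<phi> g x = y\<close>, the condition in the transformation groupoid. Hence the two categories
  have literally the same morphisms, and the same identities and composites, once an object \<open>x\<close> is
  identified with \<open>(\<star>, x)\<close>. The isomorphism therefore leaves morphisms unchanged and only adds or
  removes the component \<open>\<star>\<close> of objects.
\<close>

definition inverse_action_functor ::
    "('g, 'r) monoid_scheme \<Rightarrow> 'x set \<Rightarrow> ('g \<Rightarrow> 'x \<Rightarrow> 'x) \<Rightarrow> (unit, 'g, 'x set, 'x \<Rightarrow> 'x) fctr" where
  "inverse_action_functor G X \<phi> = \<lparr>ObMap = (\<lambda>_. X), MorMap = (\<lambda>_ _ g. \<phi> (inv\<^bsub>G\<^esub> g))\<rparr>"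

context group_action
begin

text \<open>Elements of \<^term>\<open>Bij E\<close> are extensional, so each \<^term>\<open>\<phi> g\<close> is already a morphism of
  \<^const>\<open>set_cat\<close> and need not be restricted to \<^term>\<open>E\<close>.\<close>

lemma action_in_PiE: "g \<in> carrier G \<Longrightarrow> \<phi> g \<in> E \<rightarrow>\<^sub>E E"
  using bij_prop0[of g] by (auto simp: Bij_def bij_betw_def PiE_def)

text \<open>This equivalence makes the hom-sets of the two categories coincide.\<close>

lemma action_eq_iff_inv_action:
  assumes "g \<in> carrier G" "x \<in> E" "y \<in> E"
  shows "\<phi> g x = y \<longleftrightarrow> x = \<phi> (inv g) y"
proof -
  interpret group G using group_hom by (rule group_hom.axioms)
  show ?thesis
    using assms orbit_sym_aux[of g x y] orbit_sym_aux[of "inv g" y x] by auto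
qed

text \<open>Inversion reverses products, which turns the covariance of the action into contravariance.\<close>

lemma contravariant_inverse_action_functor:
  "contravariant_functor (one_object_cat G) set_cat (inverse_action_functor G E \<phi>)"
proof -
  interpret group G using group_hom by (rule group_hom.axioms)
  have cmp: "\<phi> (inv (h \<otimes> g)) = compose E (\<phi> (inv g)) (\<phi> (inv h))"
    if "g \<in> carrier G" "h \<in> carrier G" for g h
  proof (rule extensionalityI)
    show "\<phi> (inv (h \<otimes> g)) \<in> extensional E"
      using action_in_PiE[of "inv (h \<otimes> g)"] that by (simp add: PiE_def)
    show "\<phi> (inv (h \<otimes> g)) x = compose E (\<phi> (inv g)) (\<phi> (inv h)) x" if "x \<in> E" for x
      using that \<open>g \<in> _\<close> \<open>h \<in> _\<close> by (simp add: inv_mult_group mult_action compose_def)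
  qed simp
  have one: "\<phi> \<one> = (\<lambda>x\<in>E. x)"
    using id_eq_one by simp
  show ?thesis
    by (intro contravariant_functor.intro contravariant_functor_axioms.intro
        category_one_object_cat category_set_cat)
      (simp_all add: one_object_cat_def set_cat_def inverse_action_functor_def action_in_PiE cmp one)
qed

text \<open>The isomorphism is the identity on morphisms, so each functor law reduces to one of the
  equations \<open>Mor\<close>, \<open>Idn\<close>, \<open>Cmp\<close> together with the corresponding law of the categories.\<close>

lemma isomorphic_transformation_groupoid:
  "isomorphic_cat (transformation_groupoid G E \<phi>)
     (base_structured_cat (one_object_cat G) (inverse_action_functor G E \<phi>))"
  (is "isomorphic_cat ?T ?B")
proof -
  interpret T: category ?T by (rule category_transformation_groupoid)
  interpret B: category ?B
    by (rule category_base_structured_cat[OF contravariant_inverse_action_functor])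
  have Ob: "Ob ?T = E" "Ob ?B = {()} \<times> E"
    by (auto simp: transformation_groupoid_def base_structured_cat_def one_object_cat_def
        inverse_action_functor_def)
  have Mor: "Mor ?B ((), x) ((), y) = Mor ?T x y" if "x \<in> E" "y \<in> E" for x y
    using that action_eq_iff_inv_action[of _ x y]
    by (auto simp: transformation_groupoid_def base_structured_cat_def one_object_cat_def
        inverse_action_functor_def)
  have Idn: "Idn ?B ((), x) = Idn ?T x" for x
    by (simp add: transformation_groupoid_def base_structured_cat_def one_object_cat_def)
  have Cmp: "Cmp ?B ((), x) ((), y) ((), z) g f = Cmp ?T x y z g f" for x y z g f
    by (simp add: transformation_groupoid_def base_structured_cat_def one_object_cat_def
        split: prod.split)
  let ?F = "\<lparr>ObMap = Pair (), MorMap = (\<lambda>_ _ f. f)\<rparr>"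
  let ?K = "\<lparr>ObMap = snd, MorMap = (\<lambda>_ _ f. f)\<rparr>"
  have "covariant_functor ?T ?B ?F"
    by unfold_locales (auto simp: Ob Mor Idn Cmp)
  moreover have "covariant_functor ?B ?T ?K"
    by unfold_locales (auto simp: Ob Mor Idn Cmp)
  ultimately show ?thesis
    unfolding isomorphic_cat_def
    by (intro exI[of _ ?F] exI[of _ ?K]) (auto simp: Ob)
qed

end

theorem proposition12:
  fixes G :: "('g, 'r) monoid_scheme" and X :: "'x set" and \<phi> :: "'g \<Rightarrow> 'x \<Rightarrow> 'x"
  assumes "group G"
    and "group_action G X \<phi>"
  shows "\<exists>F :: (unit, 'g, 'x set, 'x \<Rightarrow> 'x) fctr.
           contravariant_functor (one_object_cat G) set_cat F \<and>
           ObMap F () = X \<and>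
           isomorphic_cat (transformation_groupoid G X \<phi>)
             (base_structured_cat (one_object_cat G) F)"
proof -
  interpret group_action G X \<phi> by (rule assms(2))
  have "ObMap (inverse_action_functor G X \<phi>) () = X"
    by (simp add: inverse_action_functor_def)
  with contravariant_inverse_action_functor isomorphic_transformation_groupoid show ?thesis
    by blast
qed

end
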